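(* Let $Q$ be a finite quiver, let $Z$ be a set of length-two paths of $Q$ (encoded as pairs $(\alpha,\beta)$ of arrows with $t(\alpha)=s(\beta)$, the pair standing for the path $\beta\alpha$), and let $I=\langle \beta\alpha \mid (\alpha,\beta)\in Z\rangle\subseteq \Bbbk Q$ be the corresponding quadratic monomial ideal. Then $I$ is admissible if and only if the permitted transition graph $T(Q,Z)$ has no oriented cycle.
   Context: $\Bbbk$ is a field of characteristic zero. A quiver $Q$ is a finite directed graph with vertex set $Q_0$, arrow set $Q_1$ and source/target maps $s,t:Q_1\to Q_0$. Standing convention: all quivers are finite cluster quivers, i.e. they have no loops and no oriented 2-cycles. The path algebra $\Bbbk Q$ has as basis all paths (including trivial paths $e_i$, $i\in Q_0$), with multiplication by concatenation; $\beta\alpha$ denotes $\alpha$ followed by $\beta$, defined when $t(\alpha)=s(\beta)$. The arrow ideal $\mathfrak r_Q$ is the ideal generated by all arrows, and $\mathfrak r_Q^l$ is spanned by all paths of length at least $l$. An ideal $I\subseteq \Bbbk Q$ is admissible if there is an integer $m\ge 2$ with $\mathfrak r_Q^m\subseteq I\subseteq \mathfrak r_Q^2$. The permitted transition graph $T(Q,Z)$ is the directed graph whose vertices are the arrows of $Q$, with an arrow $\alpha\to\beta$ whenever $\beta\alpha$ is a composable length-two path in $Q$ and $(\alpha,\beta)\notin Z$. *)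

theory Defs
  imports
    "Graph_Theory.Arc_Walk"
    "HOL-Library.Poly_Mapping"
    "HOL-Algebra.Ideal_Product"
begin

locale cluster_quiver = fin_digraph + loopfree_digraph +
  assumes no_oriented_two_cycles:
    "\<lbrakk>a \<in> arcs G; b \<in> arcs G; head G a = tail G b\<rbrakk> \<Longrightarrow> head G b \<noteq> tail G a"

text \<open>
  A path is a pair \<open>(u, p)\<close> of its starting vertex \<open>u\<close> and the list \<open>p\<close> of its arrows in the
  order in which they are traversed; the trivial path \<open>e\<^sub>u\<close> is \<open>(u, [])\<close>, and the path written
  \<open>\<beta>\<alpha>\<close> (first \<open>\<alpha>\<close>, then \<open>\<beta>\<close>) is \<open>(tail Q \<alpha>, [\<alpha>, \<beta>])\<close>.
\<close>

type_synonym ('v, 'a) path = "'v \<times> 'a list"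

definition quiver_paths :: "('v, 'a) pre_digraph \<Rightarrow> ('v, 'a) path set" where
  "quiver_paths Q = {(u, p). \<exists>v. pre_digraph.awalk Q u p v}"

definition path_target :: "('v, 'a) pre_digraph \<Rightarrow> ('v, 'a) path \<Rightarrow> 'v" where
  "path_target Q x = last (pre_digraph.awalk_verts Q (fst x) (snd x))"

text \<open>
  The product \<open>xy\<close> of two paths is ``\<open>y\<close> followed by \<open>x\<close>'', hence the reversed order of the
  arrow lists.
\<close>

definition path_algebra ::
    "('v, 'a) pre_digraph \<Rightarrow> (('v, 'a) path \<Rightarrow>\<^sub>0 'k::field) ring" where
  "path_algebra Q =
    \<lparr>carrier = {f. Poly_Mapping.keys f \<subseteq> quiver_paths Q},
     mult = (\<lambda>f g. \<Sum>x\<in>Poly_Mapping.keys f. \<Sum>y\<in>Poly_Mapping.keys g.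
       if path_target Q y = fst x
       then Poly_Mapping.single (fst y, snd y @ snd x) (Poly_Mapping.lookup f x * Poly_Mapping.lookup g y)
       else 0),
     one = (\<Sum>v\<in>verts Q. Poly_Mapping.single (v, []) 1),
     zero = 0,
     add = (+)\<rparr>"

definition arrow_ideal ::
    "('v, 'a) pre_digraph \<Rightarrow> (('v, 'a) path \<Rightarrow>\<^sub>0 'k::field) set" where
  "arrow_ideal Q =
    Idl\<^bsub>path_algebra Q\<^esub> {Poly_Mapping.single (tail Q a, [a]) 1 | a. a \<in> arcs Q}"

text \<open>
  Powers are taken in the monoid of ideals of the path algebra. That they are the spans of the
  long paths is lemma \<open>arrow_ideal_power_eq\<close> below.
\<close>

definition arrow_ideal_power ::
    "('v, 'a) pre_digraph \<Rightarrow> nat \<Rightarrow> (('v, 'a) path \<Rightarrow>\<^sub>0 'k::field) set" where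
  "arrow_ideal_power Q l = arrow_ideal Q [^]\<^bsub>ideals_set (path_algebra Q)\<^esub> l"

definition admissible ::
    "('v, 'a) pre_digraph \<Rightarrow> (('v, 'a) path \<Rightarrow>\<^sub>0 'k::field) set \<Rightarrow> bool" where
  "admissible Q I \<longleftrightarrow>
    ideal I (path_algebra Q) \<and>
    (\<exists>m\<ge>2. arrow_ideal_power Q m \<subseteq> I \<and> I \<subseteq> arrow_ideal_power Q 2)"

definition length_two_paths :: "('v, 'a) pre_digraph \<Rightarrow> ('a \<times> 'a) set" where
  "length_two_paths Q = {(a, b). a \<in> arcs Q \<and> b \<in> arcs Q \<and> head Q a = tail Q b}"

definition quadratic_monomial_ideal ::
    "('v, 'a) pre_digraph \<Rightarrow> ('a \<times> 'a) set \<Rightarrow> (('v, 'a) path \<Rightarrow>\<^sub>0 'k::field) set" where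
  "quadratic_monomial_ideal Q Z =
    Idl\<^bsub>path_algebra Q\<^esub> {Poly_Mapping.single (tail Q a, [a, b]) 1 | a b. (a, b) \<in> Z}"

definition transition_graph ::
    "('v, 'a) pre_digraph \<Rightarrow> ('a \<times> 'a) set \<Rightarrow> ('a, 'a \<times> 'a) pre_digraph" where
  "transition_graph Q Z =
    \<lparr>verts = arcs Q, arcs = length_two_paths Q - Z, tail = fst, head = snd\<rparr>"

subsection \<open>The path algebra is a ring, and the powers of the arrow ideal\<close>

lemma path_algebra_simps:
  "carrier (path_algebra Q) = {f. Poly_Mapping.keys f \<subseteq> quiver_paths Q}"
  "\<zero>\<^bsub>path_algebra Q\<^esub> = 0"
  "f \<oplus>\<^bsub>path_algebra Q\<^esub> g = f + g"
  "\<one>\<^bsub>path_algebra Q\<^esub> = (\<Sum>v\<in>verts Q. Poly_Mapping.single (v, []) 1)"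
  by (simp_all add: path_algebra_def)

lemma path_algebra_mult:
  assumes "finite A" "finite B" "Poly_Mapping.keys f \<subseteq> A" "Poly_Mapping.keys g \<subseteq> B"
  shows "f \<otimes>\<^bsub>path_algebra Q\<^esub> g = (\<Sum>x\<in>A. \<Sum>y\<in>B.
       if path_target Q y = fst x
       then Poly_Mapping.single (fst y, snd y @ snd x) (Poly_Mapping.lookup f x * Poly_Mapping.lookup g y) else 0)"
proof -
  have "f \<otimes>\<^bsub>path_algebra Q\<^esub> g = (\<Sum>x\<in>Poly_Mapping.keys f. \<Sum>y\<in>B.
       if path_target Q y = fst x
       then Poly_Mapping.single (fst y, snd y @ snd x) (Poly_Mapping.lookup f x * Poly_Mapping.lookup g y) else 0)"
    unfolding path_algebra_def monoid.simps
    by (intro sum.cong refl sum.mono_neutral_left) (use assms in \<open>auto simp: in_keys_iff\<close>)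
  also have "\<dots> = (\<Sum>x\<in>A. \<Sum>y\<in>B.
       if path_target Q y = fst x
       then Poly_Mapping.single (fst y, snd y @ snd x) (Poly_Mapping.lookup f x * Poly_Mapping.lookup g y) else 0)"
    by (intro sum.mono_neutral_left) (use assms in \<open>auto simp: in_keys_iff intro!: sum.neutral\<close>)
  finally show ?thesis .
qed

lemma path_algebra_mult_single:
  "Poly_Mapping.single x a \<otimes>\<^bsub>path_algebra Q\<^esub> Poly_Mapping.single y b =
    (if path_target Q y = fst x then Poly_Mapping.single (fst y, snd y @ snd x) (a * b) else 0)"
  by (subst path_algebra_mult[of "{x}" "{y}"]) auto

lemma path_algebra_add_mult:
  "(f + g) \<otimes>\<^bsub>path_algebra Q\<^esub> h = f \<otimes>\<^bsub>path_algebra Q\<^esub> h + g \<otimes>\<^bsub>path_algebra Q\<^esub> h"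
proof -
  let ?A = "Poly_Mapping.keys f \<union> Poly_Mapping.keys g" and ?B = "Poly_Mapping.keys h"
  have k: "Poly_Mapping.keys (f + g) \<subseteq> ?A" by (rule Poly_Mapping.keys_add)
  show ?thesis
    by (subst (1 2 3) path_algebra_mult[of ?A ?B])
      (use k in \<open>auto simp: lookup_add distrib_right single_add
        simp flip: sum.distrib intro!: sum.cong\<close>)
qed

lemma path_algebra_mult_add:
  "h \<otimes>\<^bsub>path_algebra Q\<^esub> (f + g) = h \<otimes>\<^bsub>path_algebra Q\<^esub> f + h \<otimes>\<^bsub>path_algebra Q\<^esub> g"
proof -
  let ?A = "Poly_Mapping.keys f \<union> Poly_Mapping.keys g" and ?B = "Poly_Mapping.keys h"
  have k: "Poly_Mapping.keys (f + g) \<subseteq> ?A" by (rule Poly_Mapping.keys_add)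
  show ?thesis
    by (subst (1 2 3) path_algebra_mult[of ?B ?A])
      (use k in \<open>auto simp: lookup_add distrib_left single_add
        simp flip: sum.distrib intro!: sum.cong\<close>)
qed

lemma path_algebra_zero_mult: "0 \<otimes>\<^bsub>path_algebra Q\<^esub> h = 0"
  and path_algebra_mult_zero: "h \<otimes>\<^bsub>path_algebra Q\<^esub> 0 = 0"
  by (simp_all add: path_algebra_def)

lemma path_algebra_sum_mult:
  "(\<Sum>i\<in>S. f i) \<otimes>\<^bsub>path_algebra Q\<^esub> h = (\<Sum>i\<in>S. f i \<otimes>\<^bsub>path_algebra Q\<^esub> h)"
  by (induction S rule: infinite_finite_induct)
    (simp_all add: path_algebra_zero_mult path_algebra_add_mult)

lemma path_algebra_mult_sum:
  "h \<otimes>\<^bsub>path_algebra Q\<^esub> (\<Sum>i\<in>S. f i) = (\<Sum>i\<in>S. h \<otimes>\<^bsub>path_algebra Q\<^esub> f i)"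
  by (induction S rule: infinite_finite_induct)
    (simp_all add: path_algebra_mult_zero path_algebra_mult_add)

lemma poly_mapping_induct_single [case_names zero add]:
  fixes h :: "'a \<Rightarrow>\<^sub>0 'b::comm_monoid_add"
  assumes "P 0" "\<And>x c f. x \<in> Poly_Mapping.keys h \<Longrightarrow> P f \<Longrightarrow> P (Poly_Mapping.single x c + f)"
  shows "P h"
proof -
  have "P (\<Sum>x\<in>S. Poly_Mapping.single x (Poly_Mapping.lookup h x))" if "finite S" "S \<subseteq> Poly_Mapping.keys h" for S
    using that by (induction S) (auto intro: assms)
  moreover have "(\<Sum>x\<in>Poly_Mapping.keys h. Poly_Mapping.single x (Poly_Mapping.lookup h x)) = h"
    by (rule poly_mapping_eqI)
      (auto simp: lookup_sum lookup_single when_def in_keys_iff)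
  ultimately show ?thesis by (metis finite_keys order_refl)
qed

lemma path_target_append:
  "path_target Q (u, p @ q) = path_target Q (path_target Q (u, p), q)"
proof -
  have ne: "pre_digraph.awalk_verts Q v r \<noteq> []" for v r by (cases r) (auto simp: pre_digraph.awalk_verts.simps)
  show ?thesis
    by (induction p arbitrary: u) (auto simp: path_target_def pre_digraph.awalk_verts.simps ne)
qed

lemma path_algebra_mult_assoc:
  "f \<otimes>\<^bsub>path_algebra Q\<^esub> g \<otimes>\<^bsub>path_algebra Q\<^esub> h = f \<otimes>\<^bsub>path_algebra Q\<^esub> (g \<otimes>\<^bsub>path_algebra Q\<^esub> h)"
proof (induction f rule: poly_mapping_induct_single)
  case (add x a f)
  have "Poly_Mapping.single x a \<otimes>\<^bsub>path_algebra Q\<^esub> g \<otimes>\<^bsub>path_algebra Q\<^esub> h =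
    Poly_Mapping.single x a \<otimes>\<^bsub>path_algebra Q\<^esub> (g \<otimes>\<^bsub>path_algebra Q\<^esub> h)"
  proof (induction g rule: poly_mapping_induct_single)
    case (add y b g)
    have "Poly_Mapping.single x a \<otimes>\<^bsub>path_algebra Q\<^esub> Poly_Mapping.single y b \<otimes>\<^bsub>path_algebra Q\<^esub> h =
      Poly_Mapping.single x a \<otimes>\<^bsub>path_algebra Q\<^esub> (Poly_Mapping.single y b \<otimes>\<^bsub>path_algebra Q\<^esub> h)"
    proof (induction h rule: poly_mapping_induct_single)
      case (add z c h)
      show ?case
        using add path_target_append[of Q "fst z" "snd z" "snd y"]
        by (auto simp: path_algebra_mult_add path_algebra_mult_single path_algebra_mult_zero
            path_algebra_zero_mult mult.assoc)
    qed (simp add: path_algebra_mult_zero)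
    with add show ?case by (simp add: path_algebra_mult_add path_algebra_add_mult)
  qed (simp add: path_algebra_mult_zero path_algebra_zero_mult)
  with add show ?case by (simp add: path_algebra_add_mult)
qed (simp add: path_algebra_zero_mult)

context wf_digraph
begin

lemma path_target_eq: "path_target G (u, p) = awlast u p"
  by (simp add: path_target_def)

lemma mem_quiver_paths:
  "(u, p) \<in> quiver_paths G \<longleftrightarrow> awalk u p (path_target G (u, p))"
  by (auto simp: quiver_paths_def path_target_eq)

lemma quiver_paths_append:
  "path_target G (u, p) = v \<Longrightarrow> (u, p) \<in> quiver_paths G \<Longrightarrow> (v, q) \<in> quiver_paths G \<Longrightarrow>
    (u, p @ q) \<in> quiver_paths G"
  by (auto simp: quiver_paths_def awalk_append_iff path_target_eq)

lemma path_algebra_mult_closed: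
  assumes "Poly_Mapping.keys f \<subseteq> quiver_paths G" "Poly_Mapping.keys g \<subseteq> quiver_paths G"
  shows "Poly_Mapping.keys (f \<otimes>\<^bsub>path_algebra G\<^esub> g) \<subseteq>
    {(u, p @ q) | u p q. (u, p) \<in> Poly_Mapping.keys g \<and> (path_target G (u, p), q) \<in> Poly_Mapping.keys f}"
  (is "_ \<subseteq> ?S")
  unfolding path_algebra_def monoid.simps
  by (rule order.trans[OF keys_sum] UN_least)+
    (fastforce split: if_splits)

end

lemma (in fin_digraph) path_algebra_ring:
  "ring (path_algebra G :: (('a, 'b) path \<Rightarrow>\<^sub>0 'k::field) ring)"
proof (rule ringI)
  let ?R = "path_algebra G :: (('a, 'b) path \<Rightarrow>\<^sub>0 'k) ring"
  show "abelian_group ?R"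
  proof (rule abelian_groupI)
    fix f assume "f \<in> carrier ?R"
    then show "\<exists>g\<in>carrier ?R. g \<oplus>\<^bsub>?R\<^esub> f = \<zero>\<^bsub>?R\<^esub>"
      by (intro bexI[of _ "- f"]) (auto simp: path_algebra_simps in_keys_iff)
  next
    fix f g assume "f \<in> carrier ?R" "g \<in> carrier ?R"
    then show "f \<oplus>\<^bsub>?R\<^esub> g \<in> carrier ?R"
      using Poly_Mapping.keys_add[of f g] unfolding path_algebra_simps by blast
  qed (simp_all add: path_algebra_simps ac_simps)
  have triv: "(v, []) \<in> quiver_paths G \<longleftrightarrow> v \<in> verts G" for v
    by (auto simp: quiver_paths_def awalk_Nil_iff)
  show "Group.monoid ?R"
  proof (rule monoidI)
    fix f g assume "f \<in> carrier ?R" "g \<in> carrier ?R"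
    then show "f \<otimes>\<^bsub>?R\<^esub> g \<in> carrier ?R"
      using path_algebra_mult_closed[of f g] quiver_paths_append
      by (fastforce simp: path_algebra_simps)
  next
    show "\<one>\<^bsub>?R\<^esub> \<in> carrier ?R"
      unfolding path_algebra_simps mem_Collect_eq
      by (rule order.trans[OF keys_sum]) (auto simp: triv)
  next
    fix f :: "('a, 'b) path \<Rightarrow>\<^sub>0 'k" assume f: "f \<in> carrier ?R"
    have *: "\<one>\<^bsub>?R\<^esub> \<otimes>\<^bsub>?R\<^esub> Poly_Mapping.single x c = Poly_Mapping.single x c"
      "Poly_Mapping.single x c \<otimes>\<^bsub>?R\<^esub> \<one>\<^bsub>?R\<^esub> = Poly_Mapping.single x c"
      if "x \<in> quiver_paths G" for x c
    proof -
      obtain u p where x: "x = (u, p)" by force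
      have "u \<in> verts G" "path_target G x \<in> verts G"
        using that unfolding x mem_quiver_paths by auto
      moreover have "path_target G (v, []) = v" for v by (simp add: path_target_eq)
      ultimately show "\<one>\<^bsub>?R\<^esub> \<otimes>\<^bsub>?R\<^esub> Poly_Mapping.single x c = Poly_Mapping.single x c"
        "Poly_Mapping.single x c \<otimes>\<^bsub>?R\<^esub> \<one>\<^bsub>?R\<^esub> = Poly_Mapping.single x c"
        by (simp_all add: path_algebra_simps path_algebra_sum_mult path_algebra_mult_sum
            path_algebra_mult_single x)
    qed
    have k: "x \<in> quiver_paths G" if "x \<in> Poly_Mapping.keys f" for x
      using f that by (auto simp: path_algebra_simps)
    show "\<one>\<^bsub>?R\<^esub> \<otimes>\<^bsub>?R\<^esub> f = f"
      by (rule poly_mapping_induct_single[where h = f])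
        (simp_all add: path_algebra_mult_zero path_algebra_mult_add * k)
    show "f \<otimes>\<^bsub>?R\<^esub> \<one>\<^bsub>?R\<^esub> = f"
      by (rule poly_mapping_induct_single[where h = f])
        (simp_all add: path_algebra_zero_mult path_algebra_add_mult * k)
  qed (simp add: path_algebra_mult_assoc)
qed (simp_all add: path_algebra_simps path_algebra_mult_add path_algebra_add_mult)

definition long_path_span ::
    "('v, 'a) pre_digraph \<Rightarrow> nat \<Rightarrow> (('v, 'a) path \<Rightarrow>\<^sub>0 'k::field) set" where
  "long_path_span Q l = {f. Poly_Mapping.keys f \<subseteq> {x \<in> quiver_paths Q. l \<le> length (snd x)}}"

context fin_digraph
begin

lemma ideal_long_path_span:
  "ideal (long_path_span G l :: (('a, 'b) path \<Rightarrow>\<^sub>0 'k::field) set) (path_algebra G)"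
proof (rule idealI)
  let ?R = "path_algebra G :: (('a, 'b) path \<Rightarrow>\<^sub>0 'k) ring"
  interpret R: ring ?R by (rule path_algebra_ring)
  show "ring ?R" by (rule path_algebra_ring)
  show "subgroup (long_path_span G l) (add_monoid ?R)"
  proof (rule R.add.subgroupI)
    fix f :: "('a, 'b) path \<Rightarrow>\<^sub>0 'k" assume f: "f \<in> long_path_span G l"
    have "\<ominus>\<^bsub>?R\<^esub> f = - f"
      using f by (intro R.minus_equality)
        (auto simp: path_algebra_simps long_path_span_def in_keys_iff)
    then show "\<ominus>\<^bsub>?R\<^esub> f \<in> long_path_span G l"
      using f by (auto simp: long_path_span_def in_keys_iff)
  next
    fix f g :: "('a, 'b) path \<Rightarrow>\<^sub>0 'k"
    assume "f \<in> long_path_span G l" "g \<in> long_path_span G l"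
    then show "f \<oplus>\<^bsub>?R\<^esub> g \<in> long_path_span G l"
      using Poly_Mapping.keys_add[of f g] unfolding path_algebra_simps long_path_span_def by blast
  next
    have "0 \<in> long_path_span G l" by (simp add: long_path_span_def)
    then show "long_path_span G l \<noteq> {}" by blast
  qed (auto simp: long_path_span_def path_algebra_simps)
  fix f g :: "('a, 'b) path \<Rightarrow>\<^sub>0 'k"
  assume f: "f \<in> long_path_span G l" and g: "g \<in> carrier ?R"
  show "g \<otimes>\<^bsub>?R\<^esub> f \<in> long_path_span G l"
    using f g path_algebra_mult_closed[of g f] quiver_paths_append
    by (fastforce simp: long_path_span_def path_algebra_simps)
  show "f \<otimes>\<^bsub>?R\<^esub> g \<in> long_path_span G l"
    using f g path_algebra_mult_closed[of f g] quiver_paths_append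
    by (fastforce simp: long_path_span_def path_algebra_simps)
qed

lemma ideal_arrow_ideal:
  "ideal (arrow_ideal G :: (('a, 'b) path \<Rightarrow>\<^sub>0 'k::field) set) (path_algebra G)"
proof -
  have "{Poly_Mapping.single (tail G a, [a]) 1 | a. a \<in> arcs G} \<subseteq>
      carrier (path_algebra G :: (('a, 'b) path \<Rightarrow>\<^sub>0 'k) ring)"
    by (auto simp: path_algebra_simps quiver_paths_def) (blast intro: arc_implies_awalk)
  then show ?thesis
    unfolding arrow_ideal_def by (rule ring.genideal_ideal[OF path_algebra_ring])
qed

lemma arrow_ideal_power_Suc:
  "arrow_ideal_power G (Suc l) =
    ideal_prod (path_algebra G) (arrow_ideal_power G l) (arrow_ideal G)"
  by (simp add: arrow_ideal_power_def ideals_set_def)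

lemma ideal_arrow_ideal_power:
  "ideal (arrow_ideal_power G l :: (('a, 'b) path \<Rightarrow>\<^sub>0 'k::field) set) (path_algebra G)"
proof (induction l)
  case 0
  show ?case
    by (simp add: arrow_ideal_power_def ideals_set_def ring.oneideal[OF path_algebra_ring])
next
  case (Suc l)
  then show ?case
    unfolding arrow_ideal_power_Suc
    by (rule ring.ideal_prod_is_ideal[OF path_algebra_ring _ ideal_arrow_ideal])
qed

lemma single_mem_arrow_ideal_power:
  assumes "(u, p) \<in> quiver_paths G" "l \<le> length p"
  shows "Poly_Mapping.single (u, p) (c :: 'k::field) \<in> arrow_ideal_power G l"
  using assms
proof (induction l arbitrary: u p)
  case 0
  then show ?case by (simp add: arrow_ideal_power_def ideals_set_def path_algebra_simps)
next
  case (Suc l)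
  then obtain e q where p: "p = e # q" by (cases p) auto
  have e: "e \<in> arcs G" "u = tail G e" and q: "(head G e, q) \<in> quiver_paths G"
    using Suc.prems unfolding p by (auto simp: quiver_paths_def awalk_Cons_iff)
  have "Poly_Mapping.single (head G e, q) c \<in> arrow_ideal_power G l"
    using Suc p q by simp
  moreover have "Poly_Mapping.single (tail G e, [e]) (1 :: 'k) \<in> arrow_ideal G"
    using e unfolding arrow_ideal_def genideal_def by blast
  ultimately have "Poly_Mapping.single (head G e, q) c \<otimes>\<^bsub>path_algebra G\<^esub>
      Poly_Mapping.single (tail G e, [e]) 1 \<in> arrow_ideal_power G (Suc l)"
    unfolding arrow_ideal_power_Suc by (rule ideal_prod.prod)
  then show ?case
    by (simp add: path_algebra_mult_single path_target_eq p e)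
qed

theorem arrow_ideal_power_eq:
  "(arrow_ideal_power G l :: (('a, 'b) path \<Rightarrow>\<^sub>0 'k::field) set) = long_path_span G l"
proof (intro subset_antisym subsetI)
  fix f :: "('a, 'b) path \<Rightarrow>\<^sub>0 'k"
  let ?R = "path_algebra G :: (('a, 'b) path \<Rightarrow>\<^sub>0 'k) ring"
  have I: "additive_subgroup (arrow_ideal_power G l) ?R"
    by (rule ideal.axioms(1)[OF ideal_arrow_ideal_power])
  assume f: "f \<in> long_path_span G l"
  have single: "Poly_Mapping.single x c \<in> arrow_ideal_power G l"
    if "x \<in> Poly_Mapping.keys f" for x and c :: 'k
    using f that single_mem_arrow_ideal_power[of "fst x" "snd x" l c]
    by (auto simp: long_path_span_def)
  have zero: "(0 :: ('a, 'b) path \<Rightarrow>\<^sub>0 'k) \<in> arrow_ideal_power G l"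
    using additive_subgroup.zero_closed[OF I] unfolding path_algebra_simps .
  have add: "g + h \<in> arrow_ideal_power G l"
    if "g \<in> arrow_ideal_power G l" "h \<in> arrow_ideal_power G l" for g h :: "('a, 'b) path \<Rightarrow>\<^sub>0 'k"
    using additive_subgroup.a_closed[OF I that] unfolding path_algebra_simps .
  show "f \<in> arrow_ideal_power G l"
    by (rule poly_mapping_induct_single[where h = f]) (simp_all only: zero add single)
next
  fix f :: "('a, 'b) path \<Rightarrow>\<^sub>0 'k"
  let ?R = "path_algebra G :: (('a, 'b) path \<Rightarrow>\<^sub>0 'k) ring"
  have "arrow_ideal G \<subseteq> (long_path_span G 1 :: (('a, 'b) path \<Rightarrow>\<^sub>0 'k) set)"
    unfolding arrow_ideal_def
    by (rule ring.genideal_minimal[OF path_algebra_ring ideal_long_path_span])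
      (auto simp: long_path_span_def quiver_paths_def, blast intro: arc_implies_awalk)
  then have "arrow_ideal_power G l \<subseteq> (long_path_span G l :: (('a, 'b) path \<Rightarrow>\<^sub>0 'k) set)"
  proof (induction l)
    case 0
    show ?case
      by (auto simp: arrow_ideal_power_def ideals_set_def path_algebra_simps long_path_span_def)
  next
    case (Suc l)
    have I: "additive_subgroup (long_path_span G (Suc l)) ?R"
      by (rule ideal.axioms(1)[OF ideal_long_path_span])
    show ?case
    proof
      fix f :: "('a, 'b) path \<Rightarrow>\<^sub>0 'k"
      assume "f \<in> arrow_ideal_power G (Suc l)"
      then show "f \<in> long_path_span G (Suc l)"
        unfolding arrow_ideal_power_Suc
      proof (induction rule: ideal_prod.induct)
        case (prod f g)
        then have "f \<in> long_path_span G l" "g \<in> long_path_span G 1" using Suc by blast+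
        then show ?case
          using path_algebra_mult_closed[of f g] quiver_paths_append
          by (fastforce simp: long_path_span_def)
      qed (rule additive_subgroup.a_closed[OF I])
    qed
  qed
  then show "f \<in> long_path_span G l" if "f \<in> arrow_ideal_power G l" using that by blast
qed

end

end

theory Submission
  imports Defs
begin

text \<open>
  A monomial ideal is the span of the paths it contains, and a quadratic monomial ideal is spanned
  by the paths that run through some forbidden pair of consecutive arrows (lemma
  \<open>quadratic_monomial_ideal_eq\<close>). Since such a path has at least two arrows, the ideal always lies in
  the square of the arrow ideal. Admissibility therefore only asks that all paths of some length
  \<open>m\<close> and more be forbidden, in other words that the lengths of the permitted paths be bounded.

  A nontrivial permitted path is the same thing as a walk in the transition graph, its arrows being
  the vertices visited (lemma \<open>permitted_path_iff\<close>). So the question is whether the walks in a finite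
  digraph have bounded length. If the digraph has no oriented cycle, a walk repeats no vertex, and
  the number of arrows of the quiver is a bound. If it has one, going round it gives walks
  of every length.
\<close>

section \<open>Long walks and cycles in a finite relation\<close>

lemma not_successively_split:
  "\<not> successively P xs \<Longrightarrow> \<exists>r a b s. xs = r @ a # b # s \<and> \<not> P a b"
proof (induction P xs rule: successively.induct)
  case (3 P x y xs)
  show ?case
  proof (cases "P x y")
    case True
    with 3 obtain r a b s where "y # xs = r @ a # b # s" "\<not> P a b" by auto
    then show ?thesis by (intro exI[of _ "x # r"] exI conjI) auto
  next
    case False
    then show ?thesis by (intro exI[of _ "[]"] exI conjI) auto
  qed
qed simp_all

text \<open>
  By transitivity, each entry of a chain is related by \<open>R\<^sup>+\<close> to every later one, so a repeated entry
  would close a cycle.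
\<close>

lemma chain_distinct_if_acyclic:
  assumes "acyclic R" "successively (\<lambda>a b. (a, b) \<in> R) xs"
  shows "distinct xs"
proof -
  have "successively (\<lambda>a b. (a, b) \<in> R\<^sup>+) xs"
    using assms(2) by (rule successively_mono) auto
  moreover have "transp (\<lambda>a b. (a, b) \<in> R\<^sup>+)"
    by (auto intro: transpI)
  ultimately have "sorted_wrt (\<lambda>a b. (a, b) \<in> R\<^sup>+) xs"
    by (simp add: successively_conv_sorted_wrt)
  then show ?thesis
    using assms(1) by (induction xs) (auto simp: acyclic_def)
qed

text \<open>Every element of a cycle has a successor on the same cycle, so a chain can always go on.\<close>

lemma long_chain_if_cycle:
  assumes "(a, a) \<in> R\<^sup>+"
  shows "\<exists>xs. length xs = n \<and> successively (\<lambda>a b. (a, b) \<in> R) (a # xs)"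
  using assms
proof (induction n arbitrary: a)
  case (Suc n)
  obtain b where b: "(a, b) \<in> R" "(b, a) \<in> R\<^sup>*"
    using tranclD[OF Suc.prems] by blast
  then have "(b, b) \<in> R\<^sup>+" by (rule rtrancl_into_trancl1[rotated])
  then obtain xs where "length xs = n" "successively (\<lambda>a b. (a, b) \<in> R) (b # xs)"
    using Suc.IH by blast
  with b(1) show ?case by (intro exI[of _ "b # xs"]) simp
qed simp

text \<open>
  The chains of an acyclic relation repeat no element, so they are no longer than \<open>card A\<close>. The
  bound is kept at least two to match the exponent in the definition of admissibility.
\<close>

lemma acyclic_iff_chains_bounded:
  assumes "finite A" "R \<subseteq> A \<times> A"
  shows "acyclic R \<longleftrightarrow>
    (\<exists>m\<ge>2. \<forall>xs. set xs \<subseteq> A \<longrightarrow> successively (\<lambda>a b. (a, b) \<in> R) xs \<longrightarrow> length xs < m)"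
    (is "_ \<longleftrightarrow> ?bounded")
proof
  assume "acyclic R"
  then have "length xs \<le> card A"
    if "set xs \<subseteq> A" "successively (\<lambda>a b. (a, b) \<in> R) xs" for xs
    using that assms(1) chain_distinct_if_acyclic card_mono distinct_card by metis
  then show ?bounded
    by (intro exI[of _ "card A + 2"]) (auto simp: less_Suc_eq_le le_SucI)
next
  assume ?bounded
  then obtain m where m: "\<And>xs. set xs \<subseteq> A \<Longrightarrow> successively (\<lambda>a b. (a, b) \<in> R) xs \<Longrightarrow> length xs < m"
    by blast
  show "acyclic R"
    unfolding acyclic_def
  proof (intro allI notI)
    fix a assume cyc: "(a, a) \<in> R\<^sup>+"
    obtain xs where xs: "length xs = m" "successively (\<lambda>a b. (a, b) \<in> R) (a # xs)"
      using long_chain_if_cycle[OF cyc] by blast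
    have "a \<in> A" using tranclD[OF cyc] assms(2) by blast
    moreover have "set ys \<subseteq> A" if "successively (\<lambda>a b. (a, b) \<in> R) (b # ys)" for b ys
      using that by (induction ys arbitrary: b) (use assms(2) in auto)
    ultimately show False using m[of "a # xs"] xs by simp
  qed
qed

section \<open>Monomial ideals of the path algebra\<close>

definition path_span ::
    "('v, 'a) path set \<Rightarrow> (('v, 'a) path \<Rightarrow>\<^sub>0 'k::field) set" where
  "path_span S = {f. Poly_Mapping.keys f \<subseteq> S}"

lemma path_span_mono_iff:
  "(path_span S :: (('v, 'a) path \<Rightarrow>\<^sub>0 'k::field) set) \<subseteq> path_span T \<longleftrightarrow> S \<subseteq> T"
proof
  assume L: "(path_span S :: (('v, 'a) path \<Rightarrow>\<^sub>0 'k) set) \<subseteq> path_span T"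
  show "S \<subseteq> T"
  proof
    fix x assume "x \<in> S"
    then have "Poly_Mapping.single x (1 :: 'k) \<in> path_span S" by (simp add: path_span_def)
    with L have "Poly_Mapping.single x (1 :: 'k) \<in> path_span T" by blast
    then show "x \<in> T" by (simp add: path_span_def)
  qed
qed (auto simp: path_span_def)

definition forbidden_paths :: "('v, 'a) pre_digraph \<Rightarrow> ('a \<times> 'a) set \<Rightarrow> ('v, 'a) path set" where
  "forbidden_paths Q Z =
    {x \<in> quiver_paths Q. \<not> successively (\<lambda>a b. (a, b) \<notin> Z) (snd x)}"

text \<open>
  The product of two paths is a path or zero, so absorption under multiplication needs to be checked
  only on concatenations of paths.
\<close>

lemma (in fin_digraph) ideal_path_span:
  assumes sub: "S \<subseteq> quiver_paths G"
    and extend: "\<And>u p q. \<lbrakk>(u, p) \<in> quiver_paths G; (path_target G (u, p), q) \<in> quiver_paths G;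
      (u, p) \<in> S \<or> (path_target G (u, p), q) \<in> S\<rbrakk> \<Longrightarrow> (u, p @ q) \<in> S"
  shows "ideal (path_span S :: (('a, 'b) path \<Rightarrow>\<^sub>0 'k::field) set) (path_algebra G)"
proof (rule idealI)
  let ?R = "path_algebra G :: (('a, 'b) path \<Rightarrow>\<^sub>0 'k) ring"
  interpret R: ring ?R by (rule path_algebra_ring)
  show "ring ?R" by (rule path_algebra_ring)
  show "subgroup (path_span S) (add_monoid ?R)"
  proof (rule R.add.subgroupI)
    fix f :: "('a, 'b) path \<Rightarrow>\<^sub>0 'k" assume f: "f \<in> path_span S"
    have "\<ominus>\<^bsub>?R\<^esub> f = - f"
      using f sub by (intro R.minus_equality)
        (auto simp: path_algebra_simps path_span_def in_keys_iff)
    then show "\<ominus>\<^bsub>?R\<^esub> f \<in> path_span S"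
      using f by (auto simp: path_span_def in_keys_iff)
  next
    fix f g :: "('a, 'b) path \<Rightarrow>\<^sub>0 'k"
    assume "f \<in> path_span S" "g \<in> path_span S"
    then show "f \<oplus>\<^bsub>?R\<^esub> g \<in> path_span S"
      using Poly_Mapping.keys_add[of f g] unfolding path_algebra_simps path_span_def by blast
  next
    have "0 \<in> path_span S" by (simp add: path_span_def)
    then show "path_span S \<noteq> {}" by blast
  qed (use sub in \<open>auto simp: path_span_def path_algebra_simps\<close>)
  fix f g :: "('a, 'b) path \<Rightarrow>\<^sub>0 'k"
  assume "f \<in> path_span S" and "g \<in> carrier ?R"
  then have f: "Poly_Mapping.keys f \<subseteq> S" and g: "Poly_Mapping.keys g \<subseteq> quiver_paths G"
    by (simp_all add: path_span_def path_algebra_simps)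
  show "g \<otimes>\<^bsub>?R\<^esub> f \<in> path_span S" "f \<otimes>\<^bsub>?R\<^esub> g \<in> path_span S"
    unfolding path_span_def mem_Collect_eq
    by (rule order.trans[OF path_algebra_mult_closed]; use f g sub extend in blast)+
qed

context fin_digraph
begin

lemma ideal_forbidden_path_span:
  "ideal (path_span (forbidden_paths G Z) :: (('a, 'b) path \<Rightarrow>\<^sub>0 'k::field) set) (path_algebra G)"
  by (rule ideal_path_span)
    (auto simp: forbidden_paths_def successively_append_iff intro: quiver_paths_append)

text \<open>
  A path through a pair in \<open>Z\<close> factors as a piece before the pair, the pair, and a piece after it,
  so it is a two-sided multiple of a generator.
\<close>

lemma single_forbidden_path_mem:
  assumes Z: "Z \<subseteq> length_two_paths G" and x: "x \<in> forbidden_paths G Z"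
  shows "Poly_Mapping.single x (c :: 'k::field) \<in> quadratic_monomial_ideal G Z"
proof -
  let ?R = "path_algebra G :: (('a, 'b) path \<Rightarrow>\<^sub>0 'k) ring"
  let ?gens = "{Poly_Mapping.single (tail G a, [a, b]) (1 :: 'k) | a b. (a, b) \<in> Z}"
  obtain u p where x_pair: "x = (u, p)" by (cases x)
  then have "\<not> successively (\<lambda>a b. (a, b) \<notin> Z) p"
    using x by (simp add: forbidden_paths_def)
  from not_successively_split[OF this]
  obtain r a b s where p_eq: "p = r @ a # b # s" and ab: "(a, b) \<in> Z" by blast
  have x_eq: "x = (u, r @ a # b # s)" by (simp add: x_pair p_eq)
  have gens: "?gens \<subseteq> carrier ?R"
    using Z by (fastforce simp: path_algebra_simps quiver_paths_def length_two_paths_def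
        awalk_Cons_iff awalk_Nil_iff)
  interpret I: ideal "quadratic_monomial_ideal G Z" ?R
    unfolding quadratic_monomial_ideal_def
    by (rule ring.genideal_ideal[OF path_algebra_ring gens])
  have "awalk u (r @ a # b # s) (path_target G x)"
    using x by (simp add: forbidden_paths_def x_eq mem_quiver_paths)
  then have r: "awalk u r (tail G a)" and s: "awalk (head G b) s (path_target G x)"
    by (auto simp: awalk_Cons_iff)
  have gen: "Poly_Mapping.single (tail G a, [a, b]) (1 :: 'k) \<in> quadratic_monomial_ideal G Z"
    unfolding quadratic_monomial_ideal_def using ring.genideal_self[OF path_algebra_ring gens] ab
    by blast
  have "Poly_Mapping.single (u, r) c \<in> carrier ?R"
    and "Poly_Mapping.single (head G b, s) (1 :: 'k) \<in> carrier ?R"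
    using r s by (auto simp: path_algebra_simps quiver_paths_def)
  then have "Poly_Mapping.single (head G b, s) 1 \<otimes>\<^bsub>?R\<^esub>
      (Poly_Mapping.single (tail G a, [a, b]) 1 \<otimes>\<^bsub>?R\<^esub> Poly_Mapping.single (u, r) c)
      \<in> quadratic_monomial_ideal G Z"
    by (intro I.I_l_closed I.I_r_closed gen)
  also have "Poly_Mapping.single (head G b, s) 1 \<otimes>\<^bsub>?R\<^esub>
      (Poly_Mapping.single (tail G a, [a, b]) 1 \<otimes>\<^bsub>?R\<^esub> Poly_Mapping.single (u, r) c) =
      Poly_Mapping.single x c"
    using r by (simp add: path_algebra_mult_single path_target_append path_target_eq x_eq)
  finally show ?thesis .
qed

lemma quadratic_monomial_ideal_eq:
  assumes Z: "Z \<subseteq> length_two_paths G"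
  shows "(quadratic_monomial_ideal G Z :: (('a, 'b) path \<Rightarrow>\<^sub>0 'k::field) set) =
    path_span (forbidden_paths G Z)"
proof
  let ?R = "path_algebra G :: (('a, 'b) path \<Rightarrow>\<^sub>0 'k) ring"
  let ?gens = "{Poly_Mapping.single (tail G a, [a, b]) (1 :: 'k) | a b. (a, b) \<in> Z}"
  have gens: "?gens \<subseteq> path_span (forbidden_paths G Z)"
    using Z by (fastforce simp: path_span_def forbidden_paths_def quiver_paths_def
        length_two_paths_def awalk_Cons_iff awalk_Nil_iff)
  then show "quadratic_monomial_ideal G Z \<subseteq>
      (path_span (forbidden_paths G Z) :: (('a, 'b) path \<Rightarrow>\<^sub>0 'k) set)"
    unfolding quadratic_monomial_ideal_def
    by (rule ring.genideal_minimal[OF path_algebra_ring ideal_forbidden_path_span])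
  have "?gens \<subseteq> carrier ?R"
    using gens by (auto simp: path_span_def path_algebra_simps forbidden_paths_def)
  then have sub: "additive_subgroup (quadratic_monomial_ideal G Z) ?R"
    unfolding quadratic_monomial_ideal_def
    by (intro ideal.axioms(1) ring.genideal_ideal path_algebra_ring)
  show "(path_span (forbidden_paths G Z) :: (('a, 'b) path \<Rightarrow>\<^sub>0 'k) set) \<subseteq>
      quadratic_monomial_ideal G Z"
  proof
    fix f :: "('a, 'b) path \<Rightarrow>\<^sub>0 'k"
    assume "f \<in> path_span (forbidden_paths G Z)"
    then have keys: "Poly_Mapping.keys f \<subseteq> forbidden_paths G Z" by (simp add: path_span_def)
    show "f \<in> quadratic_monomial_ideal G Z"
    proof (induction f rule: poly_mapping_induct_single)
      case zero
      show ?case using additive_subgroup.zero_closed[OF sub] unfolding path_algebra_simps .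
    next
      case (add x c g)
      then have "Poly_Mapping.single x c \<in> quadratic_monomial_ideal G Z"
        using keys single_forbidden_path_mem[OF Z] by blast
      from additive_subgroup.a_closed[OF sub this add.IH]
      show ?case unfolding path_algebra_simps .
    qed
  qed
qed

text \<open>
  All ideals involved are spans of sets of paths, so the inclusions between them are inclusions
  between these sets. The inclusion in the square of the arrow ideal is automatic: a path containing
  a forbidden pair has length at least two.
\<close>

lemma admissible_quadratic_monomial_ideal_iff:
  assumes Z: "Z \<subseteq> length_two_paths G"
  shows "admissible G (quadratic_monomial_ideal G Z :: (('a, 'b) path \<Rightarrow>\<^sub>0 'k::field) set) \<longleftrightarrow>
    (\<exists>m\<ge>2. \<forall>x\<in>quiver_paths G. m \<le> length (snd x) \<longrightarrow> x \<in> forbidden_paths G Z)"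
proof -
  have span: "(long_path_span G l :: (('a, 'b) path \<Rightarrow>\<^sub>0 'k) set) =
      path_span {x \<in> quiver_paths G. l \<le> length (snd x)}" for l
    by (simp add: long_path_span_def path_span_def)
  have "2 \<le> length p" if "\<not> successively P p" for P :: "'b \<Rightarrow> 'b \<Rightarrow> bool" and p
    using not_successively_split[OF that] by auto
  then have "forbidden_paths G Z \<subseteq> {x \<in> quiver_paths G. 2 \<le> length (snd x)}"
    by (auto simp: forbidden_paths_def)
  then show ?thesis
    unfolding admissible_def quadratic_monomial_ideal_eq[OF Z] arrow_ideal_power_eq span
      path_span_mono_iff
    using ideal_forbidden_path_span by blast
qed

section \<open>Permitted paths as walks in the transition graph\<close>

lemma quiver_path_iff_chain:
  assumes "p \<noteq> []"
  shows "(u, p) \<in> quiver_paths G \<longleftrightarrow>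
    u = tail G (hd p) \<and> set p \<subseteq> arcs G \<and> successively (\<lambda>a b. head G a = tail G b) p"
proof -
  have "(\<exists>v. awalk u p v) \<longleftrightarrow>
    u = tail G (hd p) \<and> set p \<subseteq> arcs G \<and> successively (\<lambda>a b. head G a = tail G b) p"
    using assms
  proof (induction p arbitrary: u rule: list_nonempty_induct)
    case (cons a p)
    then show ?case by (cases p) (auto simp: awalk_Cons_iff)
  qed (auto simp: awalk_Cons_iff awalk_Nil_iff)
  then show ?thesis by (simp add: quiver_paths_def)
qed

text \<open>
  The trivial paths must be left out: their arrow list is empty and does not determine the vertex
  they sit at.
\<close>

lemma permitted_path_iff:
  assumes "p \<noteq> []"
  shows "(u, p) \<in> quiver_paths G - forbidden_paths G Z \<longleftrightarrow>
    u = tail G (hd p) \<and> set p \<subseteq> arcs G \<and>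
    successively (\<lambda>a b. (a, b) \<in> length_two_paths G - Z) p"
proof -
  have "successively (\<lambda>a b. (a, b) \<in> length_two_paths G - Z) p \<longleftrightarrow>
      successively (\<lambda>a b. head G a = tail G b) p \<and> successively (\<lambda>a b. (a, b) \<notin> Z) p"
    if "set p \<subseteq> arcs G"
    using that by (induction p rule: induct_list012) (auto simp: length_two_paths_def)
  then show ?thesis
    using quiver_path_iff_chain[OF assms] by (auto simp: forbidden_paths_def)
qed

lemma paths_eventually_forbidden_iff:
  "(\<exists>m\<ge>2. \<forall>x\<in>quiver_paths G. m \<le> length (snd x) \<longrightarrow> x \<in> forbidden_paths G Z) \<longleftrightarrow>
    acyclic (length_two_paths G - Z)"
proof -
  have "(\<forall>x\<in>quiver_paths G. m \<le> length (snd x) \<longrightarrow> x \<in> forbidden_paths G Z) \<longleftrightarrow>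
      (\<forall>p. set p \<subseteq> arcs G \<longrightarrow> successively (\<lambda>a b. (a, b) \<in> length_two_paths G - Z) p \<longrightarrow>
        length p < m)" if "2 \<le> m" for m
  proof -
    have "(\<forall>x\<in>quiver_paths G. m \<le> length (snd x) \<longrightarrow> x \<in> forbidden_paths G Z) \<longleftrightarrow>
        (\<forall>u p. m \<le> length p \<longrightarrow> (u, p) \<notin> quiver_paths G - forbidden_paths G Z)"
      by auto
    also have "\<dots> \<longleftrightarrow> (\<forall>u p. m \<le> length p \<longrightarrow> \<not> (u = tail G (hd p) \<and> set p \<subseteq> arcs G \<and>
        successively (\<lambda>a b. (a, b) \<in> length_two_paths G - Z) p))"
    proof (intro iff_allI imp_cong refl)
      fix u and p :: "'b list" assume "m \<le> length p"
      with that have "p \<noteq> []" by auto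
      then show "(u, p) \<notin> quiver_paths G - forbidden_paths G Z \<longleftrightarrow> \<not> (u = tail G (hd p) \<and>
          set p \<subseteq> arcs G \<and> successively (\<lambda>a b. (a, b) \<in> length_two_paths G - Z) p)"
        by (simp only: permitted_path_iff[OF \<open>p \<noteq> []\<close>])
    qed
    also have "\<dots> \<longleftrightarrow> (\<forall>p. m \<le> length p \<longrightarrow> \<not> (set p \<subseteq> arcs G \<and>
        successively (\<lambda>a b. (a, b) \<in> length_two_paths G - Z) p))"
      by simp
    also have "\<dots> \<longleftrightarrow> (\<forall>p. set p \<subseteq> arcs G \<longrightarrow>
        successively (\<lambda>a b. (a, b) \<in> length_two_paths G - Z) p \<longrightarrow> length p < m)"
      by (intro iff_allI) (subst not_le[symmetric], blast)
    finally show ?thesis .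
  qed
  moreover have "length_two_paths G - Z \<subseteq> arcs G \<times> arcs G"
    by (auto simp: length_two_paths_def)
  ultimately show ?thesis
    using acyclic_iff_chains_bounded[OF finite_arcs, of "length_two_paths G - Z"] by auto
qed

end

text \<open>
  A cycle visits distinct vertices, whereas a loop of the transitive closure only gives a closed
  walk; but every nonempty closed walk contains a cycle.
\<close>

lemma (in wf_digraph) ex_cycle_iff_not_acyclic:
  "(\<exists>c. cycle c) \<longleftrightarrow> \<not> acyclic (arcs_ends G)"
proof -
  have "(\<exists>c. cycle c) \<longleftrightarrow> (\<exists>c. closed_w c)"
    using closed_w_imp_cycle cycle_altdef by blast
  then show ?thesis
    by (auto simp: acyclic_def reachable1_awalk closed_w_def)
qed

lemma wf_transition_graph: "wf_digraph (transition_graph Q Z)"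
  by unfold_locales (auto simp: transition_graph_def length_two_paths_def)

lemma arcs_ends_transition_graph: "arcs_ends (transition_graph Q Z) = length_two_paths Q - Z"
  by (simp add: arcs_ends_conv transition_graph_def)

theorem proposition3p9:
  fixes Q :: "('v, 'a) pre_digraph"
    and Z :: "('a \<times> 'a) set"
    and I :: "(('v, 'a) path \<Rightarrow>\<^sub>0 'k::field_char_0) set"
  assumes "cluster_quiver Q"
    and "Z \<subseteq> length_two_paths Q"
    and "I = quadratic_monomial_ideal Q Z"
  shows "admissible Q I \<longleftrightarrow> \<not> (\<exists>c. pre_digraph.cycle (transition_graph Q Z) c)"
proof -
  interpret cluster_quiver Q by (rule assms(1))
  show ?thesis
    unfolding assms(3) admissible_quadratic_monomial_ideal_iff[OF assms(2)]
      paths_eventually_forbidden_iff wf_digraph.ex_cycle_iff_not_acyclic[OF wf_transition_graph]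
      arcs_ends_transition_graph
    by simp
qed

end
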